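(* Assume the Erdős–Sós Conjecture: for every tree $T$ with $t$ edges and every $n$, $\operatorname{ex}(n,T)\le \frac{(t-1)n}{2}$. Then for the perfect binary tree $T(2,d)$ with depth $d$, $$\operatorname{ex}^\star(n, T(2,d)) \leq \Big(\sum^{d}_{j=2} \Big[2 \prod^j_{i=2}(2^{i+1} -3)\Big]+1\Big) \frac{n}{2}.$$
   Context: Graphs are finite and simple, and all colorings are edge colorings. A $k$-ary tree is a rooted tree in which every non-leaf vertex has exactly $k$ children; a perfect $k$-ary tree is a $k$-ary tree with all leaves at the same depth (distance from the root). $T(k,d)$ denotes the perfect $k$-ary tree with depth $d$ ($d\ge 1$); $T(2,d)$ is the perfect binary tree. The Turán number $\operatorname{ex}(n,F)$ is the largest number of edges in an $n$-vertex graph with no subgraph isomorphic to $F$. A subgraph of an edge-colored graph is rainbow if all its edges have distinct colors. The rainbow Turán number $\operatorname{ex}^\star(n,F)$ is the largest number of edges among those $n$-vertex graphs that have at least one proper edge coloring containing no rainbow subgraph isomorphic to $F$ (subgraphs need not be induced). *)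

theory Defs
  imports Complex_Main
begin

type_synonym 'a sgraph = "'a set \<times> 'a set set"

abbreviation verts :: "'a sgraph \<Rightarrow> 'a set" where "verts \<equiv> fst"
abbreviation edges :: "'a sgraph \<Rightarrow> 'a set set" where "edges \<equiv> snd"

definition simple_graph :: "'a sgraph \<Rightarrow> bool" where
  "simple_graph G \<longleftrightarrow> finite (verts G) \<and> (\<forall>e\<in>edges G. e \<subseteq> verts G \<and> card e = 2)"

definition subgraph :: "'a sgraph \<Rightarrow> 'a sgraph \<Rightarrow> bool" where
  "subgraph H G \<longleftrightarrow> simple_graph H \<and> verts H \<subseteq> verts G \<and> edges H \<subseteq> edges G"

definition isomorphic :: "'a sgraph \<Rightarrow> 'b sgraph \<Rightarrow> bool" where
  "isomorphic G H \<longleftrightarrow>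
     (\<exists>f. bij_betw f (verts G) (verts H) \<and> edges H = (\<lambda>e. f ` e) ` edges G)"


subsection \<open>Trees\<close>

definition walk :: "'a sgraph \<Rightarrow> 'a list \<Rightarrow> bool" where
  "walk G p \<longleftrightarrow> p \<noteq> [] \<and> set p \<subseteq> verts G \<and> successively (\<lambda>u v. {u, v} \<in> edges G) p"

definition connected_graph :: "'a sgraph \<Rightarrow> bool" where
  "connected_graph G \<longleftrightarrow> verts G \<noteq> {} \<and>
     (\<forall>u\<in>verts G. \<forall>v\<in>verts G. \<exists>p. walk G p \<and> hd p = u \<and> last p = v)"

text \<open>The list of vertices of a cycle does not repeat its starting point at the end.\<close>

definition is_cycle :: "'a sgraph \<Rightarrow> 'a list \<Rightarrow> bool" where
  "is_cycle G p \<longleftrightarrow> walk G p \<and> distinct p \<and> 3 \<le> length p \<and> {last p, hd p} \<in> edges G"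

definition is_tree :: "'a sgraph \<Rightarrow> bool" where
  "is_tree G \<longleftrightarrow> simple_graph G \<and> connected_graph G \<and> (\<nexists>p. is_cycle G p)"

definition graph_dist :: "'a sgraph \<Rightarrow> 'a \<Rightarrow> 'a \<Rightarrow> nat" where
  "graph_dist G u v = (LEAST l. \<exists>p. walk G p \<and> hd p = u \<and> last p = v \<and> length p = Suc l)"

text \<open>In a tree \<open>T\<close> rooted at \<open>r\<close>, the children of \<open>v\<close> are its neighbours that are farther
  from the root, and a leaf is a vertex without children.\<close>

definition children :: "'a sgraph \<Rightarrow> 'a \<Rightarrow> 'a \<Rightarrow> 'a set" where
  "children T r v =
     {w \<in> verts T. {v, w} \<in> edges T \<and> graph_dist T r w = Suc (graph_dist T r v)}"

definition is_leaf :: "'a sgraph \<Rightarrow> 'a \<Rightarrow> 'a \<Rightarrow> bool" where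
  "is_leaf T r v \<longleftrightarrow> v \<in> verts T \<and> children T r v = {}"

definition kary_tree :: "nat \<Rightarrow> 'a sgraph \<Rightarrow> 'a \<Rightarrow> bool" where
  "kary_tree k T r \<longleftrightarrow> is_tree T \<and> r \<in> verts T \<and>
     (\<forall>v\<in>verts T. \<not> is_leaf T r v \<longrightarrow> card (children T r v) = k)"

text \<open>\<open>perfect_kary_tree k d T r\<close>: the graph \<open>T\<close> with root \<open>r\<close> is a copy of \<open>T(k,d)\<close>.\<close>

definition perfect_kary_tree :: "nat \<Rightarrow> nat \<Rightarrow> 'a sgraph \<Rightarrow> 'a \<Rightarrow> bool" where
  "perfect_kary_tree k d T r \<longleftrightarrow> kary_tree k T r \<and>
     (\<forall>v. is_leaf T r v \<longrightarrow> graph_dist T r v = d)"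


subsection \<open>Turan numbers\<close>

definition proper_coloring :: "'a sgraph \<Rightarrow> ('a set \<Rightarrow> 'c) \<Rightarrow> bool" where
  "proper_coloring G c \<longleftrightarrow>
     (\<forall>e\<in>edges G. \<forall>e'\<in>edges G. e \<noteq> e' \<and> e \<inter> e' \<noteq> {} \<longrightarrow> c e \<noteq> c e')"

definition rainbow :: "('a set \<Rightarrow> 'c) \<Rightarrow> 'a sgraph \<Rightarrow> bool" where
  "rainbow c H \<longleftrightarrow> inj_on c (edges H)"

definition contains_copy :: "'a sgraph \<Rightarrow> 'b sgraph \<Rightarrow> bool" where
  "contains_copy G F \<longleftrightarrow> (\<exists>H. subgraph H G \<and> isomorphic F H)"

definition contains_rainbow_copy :: "'a sgraph \<Rightarrow> ('a set \<Rightarrow> 'c) \<Rightarrow> 'b sgraph \<Rightarrow> bool" where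
  "contains_rainbow_copy G c F \<longleftrightarrow> (\<exists>H. subgraph H G \<and> isomorphic F H \<and> rainbow c H)"

text \<open>Up to isomorphism and renaming of colors, it suffices to consider finite graphs whose
  vertices and colors are natural numbers. The sets below are always finite; they are nonempty
  whenever \<open>F\<close> has an edge, so the maxima are meaningful in that case.\<close>

definition ex :: "nat \<Rightarrow> 'b sgraph \<Rightarrow> nat" where
  "ex n F = Max {card (edges G) | G :: nat sgraph.
     simple_graph G \<and> card (verts G) = n \<and> \<not> contains_copy G F}"

definition ex_star :: "nat \<Rightarrow> 'b sgraph \<Rightarrow> nat" where
  "ex_star n F = Max {card (edges G) | G :: nat sgraph.
     simple_graph G \<and> card (verts G) = n \<and>
     (\<exists>c :: nat set \<Rightarrow> nat. proper_coloring G c \<and> \<not> contains_rainbow_copy G c F)}"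

text \<open>Trees without edges are excluded: the bound would be negative for them.\<close>

definition erdos_sos_conjecture :: bool where
  "erdos_sos_conjecture \<longleftrightarrow>
     (\<forall>(T :: nat sgraph) t n. is_tree T \<and> card (edges T) = t \<and> t \<ge> 1 \<longrightarrow>
        real (ex n T) \<le> (real t - 1) * real n / 2)"

end

theory Submission
  imports Defs "HOL-Library.Nat_Bijection"
begin

text \<open>Let \<open>L\<close> be the rooted tree of depth \<open>d\<close> whose root has \<open>2\<close> children and in which
  every vertex at depth \<open>j\<close>, for \<open>1 \<le> j < d\<close>, has \<open>2 ^ (j + 2) - 3\<close> children. Every proper edge
  coloring of \<open>L\<close> contains a rainbow copy of the perfect binary tree \<open>T\<close>, found greedily
  from the root downwards, one vertex after the other. Suppose that a vertex \<open>w\<close> at depth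
  \<open>j + 1\<close>, with parent \<open>u\<close>, is to be embedded next. The part embedded so far, together with
  \<open>w\<close>, has at most \<open>2 ^ (j + 2) - 1\<close> vertices, so at most \<open>2 ^ (j + 2) - 3\<close> colors are in use. If
  \<open>j \<ge> 1\<close>, one of these is the color of the edge above \<open>u\<close>, which does not occur on the edges
  below the image of \<open>u\<close>; these edges have distinct colors, so one of them has an unused
  color. If \<open>j = 0\<close>, at most one color is in use and there are two edges to choose from. The
  new color also ensures that the new vertex is not an old one
  (\<open>rainbow_embedding_insert\<close>, \<open>ex_rainbow_embedding\<close>).

  Hence a properly colored graph without a rainbow copy of \<open>T\<close> contains no copy of \<open>L\<close>
  (\<open>contains_rainbow_copy_if_contains_level_tree\<close>), and has at most \<open>(t - 1) n / 2\<close> edges by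
  the Erdos-Sos conjecture, where \<open>t\<close> is the number of edges of \<open>L\<close>. As \<open>t\<close> is the sum of the
  sizes of the levels \<open>1, \<dots>, d\<close>, this is the claimed bound.

  The embedding uses that in a tree rooted at \<open>r\<close>, every vertex \<open>v \<noteq> r\<close> has exactly one
  neighbour that is not farther from \<open>r\<close> than \<open>v\<close>, so that the edges correspond to the pairs
  of a vertex and its parent (\<open>neighbour_above_unique\<close>, \<open>edges_eq\<close>).\<close>


section \<open>Parents in a rooted tree\<close>

locale rooted_tree =
  fixes T :: "'a sgraph" and r :: 'a
  assumes tree: "is_tree T" and root: "r \<in> verts T"
begin

abbreviation depth :: "'a \<Rightarrow> nat" where "depth \<equiv> graph_dist T r"

lemma finite_verts: "finite (verts T)"
  using tree by (simp add: is_tree_def simple_graph_def)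

lemma edge_verts: "{u, v} \<in> edges T \<Longrightarrow> u \<in> verts T \<and> v \<in> verts T"
  using tree by (auto simp: is_tree_def simple_graph_def)

lemma edge_neq: "{u, v} \<in> edges T \<Longrightarrow> u \<noteq> v"
  using tree by (auto simp: is_tree_def simple_graph_def)

lemma shortest_walk:
  assumes "v \<in> verts T"
  shows "\<exists>p. walk T p \<and> hd p = r \<and> last p = v \<and> length p = Suc (depth v)"
proof -
  obtain p where p: "walk T p" "hd p = r" "last p = v"
    using tree root assms unfolding is_tree_def connected_graph_def by blast
  moreover have "length p = Suc (length p - 1)"
    using p by (auto simp: walk_def)
  ultimately have "\<exists>l p. walk T p \<and> hd p = r \<and> last p = v \<and> length p = Suc l"
    by blast
  thus ?thesis unfolding graph_dist_def by (rule LeastI_ex)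
qed

lemma depth_le:
  assumes "walk T p" "hd p = r" "last p = v" "length p = Suc l"
  shows "depth v \<le> l"
  unfolding graph_dist_def using assms by (intro Least_le) blast

lemma depth_root [simp]: "depth r = 0"
  using depth_le[of "[r]" r 0] root by (simp add: walk_def)

lemma depth_0_imp_root:
  assumes "v \<in> verts T" "depth v = 0"
  shows "v = r"
  using shortest_walk[OF assms(1)] assms(2) by (auto simp: length_Suc_conv)

lemma depth_neighbour:
  assumes "{u, v} \<in> edges T"
  shows "depth v \<le> Suc (depth u)"
proof -
  obtain p where p: "walk T p" "hd p = r" "last p = u" "length p = Suc (depth u)"
    using shortest_walk edge_verts[OF assms] by blast
  have "walk T (p @ [v])"
    using p(1,3) assms edge_verts[OF assms] by (auto simp: walk_def successively_append_iff)
  moreover have "hd (p @ [v]) = r"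
    using p by (auto simp: walk_def)
  ultimately show ?thesis
    using p(4) by (intro depth_le[of "p @ [v]"]) auto
qed

lemma ex_neighbour_above:
  assumes "v \<in> verts T" "v \<noteq> r"
  shows "\<exists>u. {v, u} \<in> edges T \<and> depth v = Suc (depth u)"
proof -
  obtain p where p: "walk T p" "hd p = r" "last p = v" "length p = Suc (depth v)"
    using shortest_walk assms by blast
  have pn: "p \<noteq> []" using p(1) by (simp add: walk_def)
  define q where "q = butlast p"
  have pq: "p = q @ [v]"
    unfolding q_def p(3)[symmetric] using pn by (rule append_butlast_last_id[symmetric])
  have qn: "q \<noteq> []" using p(2) assms(2) pq by auto
  have q: "walk T q" and e: "{last q, v} \<in> edges T"
    using p(1) qn by (auto simp: pq walk_def successively_append_iff)
  have len: "length q = depth v" using p(4) by (simp add: pq)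
  hence "depth v > 0" using qn by (metis length_greater_0_conv)
  moreover have "hd q = r" using p(2) qn by (simp add: pq)
  hence "depth (last q) \<le> depth v - 1"
    using q len \<open>depth v > 0\<close> by (intro depth_le[of q]) auto
  moreover have "depth v \<le> Suc (depth (last q))"
    using depth_neighbour[OF e] .
  ultimately show ?thesis using e by (auto simp: insert_commute)
qed

lemma path_within:
  assumes "(a, b) \<in> {(x, y). x \<in> S \<and> y \<in> S \<and> {x, y} \<in> edges T}\<^sup>*" "a \<in> S"
  shows "\<exists>p. p \<noteq> [] \<and> distinct p \<and> set p \<subseteq> S \<and> hd p = a \<and> last p = b
           \<and> successively (\<lambda>u v. {u, v} \<in> edges T) p"
  using assms(1)
proof induction
  case base
  show ?case using assms(2) by (intro exI[of _ "[a]"]) auto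
next
  case (step b c)
  obtain p where p: "p \<noteq> []" "distinct p" "set p \<subseteq> S" "hd p = a" "last p = b"
      "successively (\<lambda>u v. {u, v} \<in> edges T) p"
    using step.IH by blast
  show ?case
  proof (cases "c \<in> set p")
    case True
    then obtain xs ys where xy: "p = xs @ c # ys" by (auto simp: in_set_conv_decomp)
    have "hd (xs @ [c]) = a" using p(4) xy by (cases xs) auto
    thus ?thesis using p xy
      by (intro exI[of _ "xs @ [c]"]) (auto simp: successively_append_iff)
  next
    case False
    thus ?thesis using p step.hyps(2)
      by (intro exI[of _ "p @ [c]"]) (auto simp: successively_append_iff)
  qed
qed

text \<open>The vertices of depth at most \<open>depth v\<close> other than \<open>v\<close> are joined to the root, and
  hence to each other, without passing through \<open>v\<close>. Two neighbours of \<open>v\<close> among them would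
  therefore close a cycle.\<close>

lemma neighbour_above_unique:
  assumes e: "{v, a} \<in> edges T" "{v, b} \<in> edges T"
    and le: "depth a \<le> depth v" "depth b \<le> depth v"
  shows "a = b"
proof (rule ccontr)
  assume ab: "a \<noteq> b"
  define S where "S = {x \<in> verts T. depth x \<le> depth v} - {v}"
  define R where "R = {(x, y). x \<in> S \<and> y \<in> S \<and> {x, y} \<in> edges T}"
  have "sym R" by (auto simp: R_def sym_def insert_commute)
  have vr: "v \<noteq> r"
  proof
    assume "v = r"
    hence "depth a = 0" "depth b = 0" using le by auto
    thus False using depth_0_imp_root edge_verts[OF e(1)] edge_verts[OF e(2)] ab by metis
  qed
  have conn: "x \<in> S \<Longrightarrow> (r, x) \<in> R\<^sup>*" for x
  proof (induction "depth x" arbitrary: x rule: less_induct)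
    case less
    show ?case
    proof (cases "x = r")
      case False
      then obtain u where u: "{x, u} \<in> edges T" "depth x = Suc (depth u)"
        using ex_neighbour_above less.prems by (auto simp: S_def)
      have "u \<in> S" using u less.prems edge_verts[OF u(1)] by (auto simp: S_def)
      moreover from this have "(r, u) \<in> R\<^sup>*" using less.hyps u(2) by auto
      moreover have "(u, x) \<in> R"
        using \<open>u \<in> S\<close> less.prems u(1) by (auto simp: R_def insert_commute)
      ultimately show ?thesis by simp
    qed auto
  qed
  have aS: "a \<in> S" and bS: "b \<in> S"
    using e le edge_verts edge_neq by (auto simp: S_def)
  have "(a, r) \<in> R\<^sup>*"
    using conn[OF aS] \<open>sym R\<close> sym_rtrancl by (metis symD)
  hence "(a, b) \<in> R\<^sup>*" using conn[OF bS] by auto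
  then obtain p where p: "p \<noteq> []" "distinct p" "set p \<subseteq> S" "hd p = a" "last p = b"
      "successively (\<lambda>u v. {u, v} \<in> edges T) p"
    using path_within[of a b S] aS unfolding R_def by blast
  obtain y ys where py: "p = a # y # ys"
    using p(1,4,5) ab by (cases p; cases "tl p") auto
  have "is_cycle T (v # p)"
    using p py e edge_verts[OF e(1)]
    by (auto simp: is_cycle_def walk_def S_def insert_commute)
  thus False using tree by (auto simp: is_tree_def)
qed

text \<open>The parent of a vertex other than the root.\<close>

definition up :: "'a \<Rightarrow> 'a" where
  "up v = (SOME u. {v, u} \<in> edges T \<and> depth v = Suc (depth u))"

lemma up:
  assumes "v \<in> verts T" "v \<noteq> r"
  shows "{v, up v} \<in> edges T" "depth v = Suc (depth (up v))" "up v \<in> verts T"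
proof -
  show "{v, up v} \<in> edges T" "depth v = Suc (depth (up v))"
    using someI_ex[OF ex_neighbour_above[OF assms]] by (auto simp: up_def)
  thus "up v \<in> verts T" using edge_verts by blast
qed

lemma up_eqI:
  assumes "{v, u} \<in> edges T" "depth u \<le> depth v"
  shows "v \<noteq> r" "u = up v"
proof -
  show "v \<noteq> r"
    using assms edge_neq[OF assms(1)] edge_verts[OF assms(1)] depth_0_imp_root[of u] by auto
  thus "u = up v"
    using neighbour_above_unique[OF assms(1) up(1)] assms up(2) edge_verts by force
qed

lemma edges_eq: "edges T = (\<lambda>v. {v, up v}) ` (verts T - {r})"
proof (intro equalityI subsetI)
  fix e assume e: "e \<in> edges T"
  have "card e = 2" using tree e by (simp add: is_tree_def simple_graph_def)
  then obtain a b where ab: "e = {a, b}" by (auto simp: card_2_iff)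
  have ab': "e = {b, a}" using ab by auto
  show "e \<in> (\<lambda>v. {v, up v}) ` (verts T - {r})"
  proof (cases "depth b \<le> depth a")
    case True
    thus ?thesis using up_eqI[of a b] edge_verts[of a b] e ab by auto
  next
    case False
    thus ?thesis using up_eqI[of b a] edge_verts[of b a] e ab' by auto
  qed
next
  fix e assume "e \<in> (\<lambda>v. {v, up v}) ` (verts T - {r})"
  thus "e \<in> edges T" using up(1) by blast
qed

lemma children_eq: "children T r v = {w \<in> verts T - {r}. up w = v}"
proof (intro equalityI subsetI)
  fix w assume "w \<in> children T r v"
  hence "w \<in> verts T" "{w, v} \<in> edges T" "depth v \<le> depth w"
    by (auto simp: children_def insert_commute)
  thus "w \<in> {w \<in> verts T - {r}. up w = v}" using up_eqI[of w v] by auto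
next
  fix w assume "w \<in> {w \<in> verts T - {r}. up w = v}"
  thus "w \<in> children T r v" using up[of w] by (auto simp: children_def insert_commute)
qed

lemma card_depth_le:
  assumes "\<And>v. v \<in> verts T \<Longrightarrow> card (children T r v) \<le> 2"
  shows "card {v \<in> verts T. depth v \<le> k} \<le> 2 ^ Suc k - 1"
proof -
  have level: "card {v \<in> verts T. depth v = k} \<le> 2 ^ k" for k
  proof (induction k)
    case 0
    have "{v \<in> verts T. depth v = 0} = {r}" using depth_0_imp_root root by auto
    thus ?case by simp
  next
    case (Suc k)
    have "{v \<in> verts T. depth v = Suc k} \<subseteq> (\<Union>v\<in>{v \<in> verts T. depth v = k}. children T r v)"
    proof
      fix v assume v: "v \<in> {v \<in> verts T. depth v = Suc k}"
      hence "v \<noteq> r" by auto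
      thus "v \<in> (\<Union>v\<in>{v \<in> verts T. depth v = k}. children T r v)"
        using v up[of v] by (auto simp: children_eq)
    qed
    hence "card {v \<in> verts T. depth v = Suc k}
        \<le> card (\<Union>v\<in>{v \<in> verts T. depth v = k}. children T r v)"
      by (rule card_mono[rotated]) (auto simp: finite_verts children_eq)
    also have "\<dots> \<le> (\<Sum>v\<in>{v \<in> verts T. depth v = k}. card (children T r v))"
      by (rule card_UN_le) (simp add: finite_verts)
    also have "\<dots> \<le> card {v \<in> verts T. depth v = k} * 2"
      using sum_bounded_above[of "{v \<in> verts T. depth v = k}" "\<lambda>v. card (children T r v)" 2]
        assms by auto
    also have "\<dots> \<le> 2 ^ Suc k" using Suc by simp
    finally show ?case .
  qed
  show ?thesis
  proof (induction k)
    case 0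
    have "{v \<in> verts T. depth v \<le> 0} = {r}" using depth_0_imp_root root by auto
    thus ?case by simp
  next
    case (Suc k)
    have "{v \<in> verts T. depth v \<le> Suc k}
        = {v \<in> verts T. depth v \<le> k} \<union> {v \<in> verts T. depth v = Suc k}"
      by auto
    hence "card {v \<in> verts T. depth v \<le> Suc k}
        \<le> card {v \<in> verts T. depth v \<le> k} + card {v \<in> verts T. depth v = Suc k}"
      by (simp add: card_Un_le)
    thus ?case using Suc level[of "Suc k"] by simp
  qed
qed

end

text \<open>A vertex at maximal distance from the root is a leaf.\<close>

lemma perfect_kary_tree_depth:
  assumes "perfect_kary_tree k d T r"
  shows "\<forall>v\<in>verts T. graph_dist T r v \<le> d" and "\<exists>v\<in>verts T. graph_dist T r v = d"
proof -
  interpret rooted_tree T r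
    using assms by unfold_locales (auto simp: perfect_kary_tree_def kary_tree_def)
  have ne: "depth ` verts T \<noteq> {}" "finite (depth ` verts T)" using root finite_verts by auto
  obtain v where v: "v \<in> verts T" "depth v = Max (depth ` verts T)"
    using Max_in[OF ne(2,1)] by auto
  have max: "depth w \<le> depth v" if "w \<in> verts T" for w
    using v(2) ne that by auto
  have "children T r v = {}" using max by (force simp: children_def)
  hence "depth v = d"
    using assms v(1) by (auto simp: perfect_kary_tree_def is_leaf_def)
  thus "\<forall>v\<in>verts T. depth v \<le> d" "\<exists>v\<in>verts T. depth v = d" using max v(1) by auto
qed


section \<open>Trees with prescribed branching at each depth\<close>

text \<open>The \<open>x\<close>-th child of \<open>v\<close>. The root is \<open>0\<close>, and every child is larger than its parent,
  which excludes cycles.\<close>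

definition child :: "nat \<Rightarrow> nat \<Rightarrow> nat" where
  "child v x = Suc (prod_encode (x, v))"

text \<open>The value at the root \<open>0\<close> is irrelevant.\<close>

definition parent :: "nat \<Rightarrow> nat" where
  "parent w = snd (prod_decode (w - 1))"

lemma parent_child [simp]: "parent (child v x) = v"
  by (simp add: parent_def child_def)

lemma child_eq_iff [simp]: "child v x = child w y \<longleftrightarrow> v = w \<and> x = y"
  by (auto simp: child_def dest: inj_onD[OF inj_prod_encode])

lemma child_neq_0 [simp]: "child v x \<noteq> 0"
  by (simp add: child_def)

lemma less_child: "v < child v x"
  using le_prod_encode_2[of v x] by (simp add: child_def)

text \<open>The vertices at depth \<open>j\<close> of the tree in which each vertex at depth \<open>i\<close> has \<open>m i\<close> children.\<close>

primrec level :: "(nat \<Rightarrow> nat) \<Rightarrow> nat \<Rightarrow> nat set" where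
  "level m 0 = {0}"
| "level m (Suc j) = (\<lambda>(v, x). child v x) ` (level m j \<times> {..<m j})"

text \<open>The tree truncated at depth \<open>d\<close>. The numbers \<open>m j\<close> with \<open>j \<ge> d\<close> play no role.\<close>

definition level_tree :: "(nat \<Rightarrow> nat) \<Rightarrow> nat \<Rightarrow> nat sgraph" where
  "level_tree m d = (\<Union>j\<le>d. level m j, (\<lambda>v. {v, parent v}) ` (\<Union>j\<in>{1..d}. level m j))"

lemma finite_level: "finite (level m j)"
  by (induction j) auto

lemma card_level: "card (level m j) = (\<Prod>i<j. m i)"
proof (induction j)
  case (Suc j)
  have "inj_on (\<lambda>(v, x). child v x) (level m j \<times> {..<m j})"
    by (auto simp: inj_on_def)
  thus ?case using Suc by (simp add: card_image card_cartesian_product)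
qed simp

lemma level_disjoint: "w \<in> level m i \<Longrightarrow> w \<in> level m j \<Longrightarrow> i = j"
proof (induction i arbitrary: j w)
  case 0
  thus ?case by (cases j) auto
next
  case (Suc i)
  then obtain j' where "j = Suc j'" by (cases j) auto
  thus ?case using Suc by auto
qed

lemma parent_in_level: "w \<in> level m (Suc j) \<Longrightarrow> parent w \<in> level m j"
  by auto

lemma parent_less: "w \<in> level m (Suc j) \<Longrightarrow> parent w < w"
  using less_child by auto

lemma card_edges_level_tree: "card (edges (level_tree m d)) = (\<Sum>j=1..d. \<Prod>i<j. m i)"
proof -
  have less: "parent v < v" if "v \<in> (\<Union>j\<in>{1..d}. level m j)" for v
  proof -
    obtain j where "j \<in> {1..d}" "v \<in> level m j" using \<open>v \<in> _\<close> by blast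
    thus ?thesis using parent_less[of v m "j - 1"] by auto
  qed
  have "inj_on (\<lambda>v. {v, parent v}) (\<Union>j\<in>{1..d}. level m j)"
  proof (rule inj_onI)
    fix v w
    assume vw: "v \<in> (\<Union>j\<in>{1..d}. level m j)" "w \<in> (\<Union>j\<in>{1..d}. level m j)"
      "{v, parent v} = {w, parent w}"
    thus "v = w" using less[OF vw(1)] less[OF vw(2)] by (auto simp: doubleton_eq_iff)
  qed
  hence "card (edges (level_tree m d)) = card (\<Union>j\<in>{1..d}. level m j)"
    by (simp add: level_tree_def card_image)
  also have "\<dots> = (\<Sum>j=1..d. card (level m j))"
    using level_disjoint by (intro card_UN_disjoint) (auto simp: finite_level)
  finally show ?thesis by (simp add: card_level)
qed

lemma level_tree_edge_cases:
  assumes "{u, v} \<in> edges (level_tree m d)"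
  shows "(u = parent v \<and> u < v) \<or> (v = parent u \<and> v < u)"
proof -
  obtain j w where w: "j \<in> {1..d}" "w \<in> level m j" "{u, v} = {w, parent w}"
    using assms by (auto simp: level_tree_def)
  moreover have "parent w < w" using w parent_less[of w m "j - 1"] by auto
  ultimately show ?thesis by (auto simp: doubleton_eq_iff)
qed

lemma simple_graph_level_tree: "simple_graph (level_tree m d)"
proof -
  have "{v, parent v} \<subseteq> (\<Union>j\<le>d. level m j) \<and> card {v, parent v} = 2"
    if jv: "j \<in> {1..d}" "v \<in> level m j" for v j
  proof -
    obtain i where i: "j = Suc i" using jv(1) by (cases j) auto
    have "parent v \<in> level m i" "parent v < v" "i \<le> d"
      using parent_in_level[of v m i] parent_less[of v m i] jv i by auto
    thus ?thesis using jv by auto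
  qed
  thus ?thesis by (auto simp: simple_graph_def level_tree_def finite_level)
qed

lemma connected_level_tree: "connected_graph (level_tree m d)"
proof -
  let ?G = "level_tree m d"
  let ?adj = "\<lambda>u v. {u, v} \<in> edges ?G"
  have sym: "(\<lambda>u v. ?adj v u) = ?adj" by (simp add: insert_commute)
  have up: "\<exists>p. walk ?G p \<and> hd p = v \<and> last p = 0" if "v \<in> level m j" "j \<le> d" for v j
    using that
  proof (induction j arbitrary: v)
    case 0
    have "0 \<in> verts ?G" by (force simp: level_tree_def)
    thus ?case using 0 by (intro exI[of _ "[0]"]) (simp add: walk_def)
  next
    case (Suc j)
    obtain p where p: "walk ?G p" "hd p = parent v" "last p = 0"
      using Suc.IH[OF parent_in_level[OF Suc.prems(1)]] Suc.prems by auto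
    have "Suc j \<in> {1..d}" using Suc.prems by auto
    hence "{v, parent v} \<in> edges ?G" "v \<in> verts ?G"
      using Suc.prems by (force simp: level_tree_def simp del: level.simps)+
    thus ?case using p
      by (intro exI[of _ "v # p"]) (cases p; auto simp: walk_def)
  qed
  have "\<exists>p. walk ?G p \<and> hd p = u \<and> last p = v" if uv: "u \<in> verts ?G" "v \<in> verts ?G" for u v
  proof -
    obtain p where p: "walk ?G p" "hd p = u" "last p = 0"
      using up uv(1) by (auto simp: level_tree_def)
    obtain q where q: "walk ?G q" "hd q = v" "last q = 0"
      using up uv(2) by (auto simp: level_tree_def)
    obtain q' where q': "rev q = 0 # q'"
      using q by (cases "rev q") (auto simp: walk_def hd_rev[symmetric])
    have rq: "successively ?adj (rev q)" 
      unfolding successively_rev by (subst sym) (use q(1) in \<open>simp add: walk_def\<close>)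
    have "last (p @ q') = v"
    proof (cases "q' = []")
      case True
      thus ?thesis using q' q(2) p(3) by (metis append_Nil2 hd_rev last.simps rev_rev_ident)
    next
      case False
      hence "last (rev q) = last q'" using q' by simp
      thus ?thesis using False q by (simp add: last_rev walk_def)
    qed
    moreover have "walk ?G (p @ q')"
    proof -
      have "set q' \<subseteq> set (rev q)" using q' by auto
      moreover have "successively ?adj q'" "q' \<noteq> [] \<Longrightarrow> ?adj 0 (hd q')"
        using rq unfolding q' by (cases q'; simp)+
      ultimately show ?thesis
        using p q(1) by (auto simp: walk_def successively_append_iff)
    qed
    moreover have "hd (p @ q') = u" using p by (auto simp: walk_def)
    ultimately show ?thesis by blast
  qed
  moreover have "0 \<in> verts ?G" by (force simp: level_tree_def)
  ultimately show ?thesis unfolding connected_graph_def by blast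
qed

text \<open>The largest vertex of a cycle would have two distinct neighbours on the cycle, both
  equal to its parent.\<close>

lemma acyclic_level_tree: "\<not> is_cycle (level_tree m d) p"
proof
  assume "is_cycle (level_tree m d) p"
  hence p: "successively (\<lambda>u v. {u, v} \<in> edges (level_tree m d)) p"
      "distinct p" "3 \<le> length p" "{last p, hd p} \<in> edges (level_tree m d)"
    by (auto simp: is_cycle_def walk_def)
  let ?n = "length p"
  have pn: "p \<noteq> []" using p(3) by auto
  have step: "{p ! i, p ! (Suc i mod ?n)} \<in> edges (level_tree m d)" if "i < ?n" for i
  proof (cases "Suc i = ?n")
    case True
    hence "i = ?n - 1" by simp
    thus ?thesis using True p(4) pn by (simp add: last_conv_nth hd_conv_nth)
  next
    case False
    thus ?thesis using p(1) that by (auto simp: successively_conv_nth)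
  qed
  have "Max (set p) \<in> set p" using pn by simp
  then obtain i where i: "i < ?n" "p ! i = Max (set p)" by (auto simp: in_set_conv_nth)
  define j where "j = (if i = 0 then ?n - 1 else i - 1)"
  define k where "k = Suc i mod ?n"
  have j: "j < ?n" "Suc j mod ?n = i" using i(1) p(3) by (auto simp: j_def)
  have k: "k < ?n" using pn by (simp add: k_def)
  have jk: "j \<noteq> k"
    using i(1) p(3) by (cases "Suc i = ?n") (auto simp: j_def k_def)
  have le: "p ! l \<le> p ! i" if "l < ?n" for l using i(2) that by simp
  have "p ! k = parent (p ! i)"
    using level_tree_edge_cases[OF step[OF i(1)]] le[OF k] by (auto simp: k_def)
  moreover have "p ! j = parent (p ! i)"
    using level_tree_edge_cases[OF step[OF j(1)]] le[OF j(1)] j(2) by auto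
  ultimately show False using jk p(2) j(1) k by (metis nth_eq_iff_index_eq)
qed

lemma is_tree_level_tree: "is_tree (level_tree m d)"
  using simple_graph_level_tree connected_level_tree acyclic_level_tree
  by (auto simp: is_tree_def)


section \<open>Greedy rainbow embedding\<close>

text \<open>A proper coloring of the edges of a level tree, given by the color \<open>\<kappa> w\<close> of the edge from
  \<open>w\<close> to its parent; the value \<open>\<kappa> 0\<close> is irrelevant.\<close>

definition proper_up_coloring :: "(nat \<Rightarrow> nat) \<Rightarrow> nat \<Rightarrow> (nat \<Rightarrow> 'c) \<Rightarrow> bool" where
  "proper_up_coloring m d \<kappa> \<longleftrightarrow>
     (\<forall>j<d. \<forall>v\<in>level m j. inj_on (\<lambda>x. \<kappa> (child v x)) {..<m j} \<and>
        (v \<noteq> 0 \<longrightarrow> (\<forall>x<m j. \<kappa> (child v x) \<noteq> \<kappa> v)))"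

context rooted_tree
begin

text \<open>The map \<open>h\<close> embeds the part \<open>S\<close> of the tree into a level tree, respecting depths and
  parents, and its image is rainbow. Injectivity of \<open>h\<close> need not be required: off the root it
  follows from distinct colors, and the root is alone at depth \<open>0\<close>.\<close>

definition rainbow_embedding ::
  "(nat \<Rightarrow> nat) \<Rightarrow> (nat \<Rightarrow> 'c) \<Rightarrow> 'a set \<Rightarrow> ('a \<Rightarrow> nat) \<Rightarrow> bool" where
  "rainbow_embedding m \<kappa> S h \<longleftrightarrow>
     (\<forall>v\<in>S. h v \<in> level m (depth v)) \<and>
     (\<forall>v\<in>S - {r}. parent (h v) = h (up v)) \<and> inj_on (\<lambda>v. \<kappa> (h v)) (S - {r})"

text \<open>The edge from \<open>up w\<close> to its own parent blocks no color for \<open>w\<close>, since \<open>\<kappa>\<close> is proper. This is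
  the extra \<open>1\<close> in the hypothesis \<open>room\<close>.\<close>

lemma rainbow_embedding_insert:
  assumes col: "proper_up_coloring m d \<kappa>"
    and h: "rainbow_embedding m \<kappa> S h"
    and S: "S \<subseteq> verts T" "\<And>v. v \<in> S - {r} \<Longrightarrow> up v \<in> S"
    and w: "w \<in> verts T" "w \<noteq> r" "w \<notin> S" "up w \<in> S" "depth w \<le> d"
    and room: "card (S - {r}) < m (depth (up w)) + (if up w = r then 0 else 1)"
  shows "\<exists>h. rainbow_embedding m \<kappa> (insert w S) h"
proof -
  define u where "u = up w"
  define j where "j = depth u"
  have dw: "depth w = Suc j" using up(2)[OF w(1,2)] by (simp add: j_def u_def)
  have uS: "u \<in> S" using w(4) by (simp add: u_def)
  have jd: "j < d" using dw w(5) by simp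
  have hu: "h u \<in> level m j" using h uS by (auto simp: rainbow_embedding_def j_def)
  have hu0: "h u \<noteq> 0" if "u \<noteq> r"
  proof
    assume "h u = 0"
    hence "j = 0" using hu level_disjoint[of 0 m j 0] by simp
    thus False using that depth_0_imp_root[of u] uS S(1) by (auto simp: j_def)
  qed
  have finS: "finite S" using S(1) finite_verts finite_subset by blast
  define B where "B = (\<lambda>v. \<kappa> (h v)) ` (S - {r} - {u})"
  have inj: "inj_on (\<lambda>x. \<kappa> (child (h u) x)) {..<m j}"
    using col jd hu by (auto simp: proper_up_coloring_def)
  have "card B \<le> card (S - {r} - {u})"
    unfolding B_def using finS by (intro card_image_le) auto
  also have "\<dots> < m j"
  proof (cases "u = r")
    case True
    thus ?thesis using room by (simp add: u_def j_def)
  next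
    case False
    hence "card (S - {r} - {u}) = card (S - {r}) - 1" "card (S - {r}) > 0"
      using uS finS by (auto simp: card_gt_0_iff)
    thus ?thesis using room False by (simp add: u_def j_def)
  qed
  also have "m j = card ((\<lambda>x. \<kappa> (child (h u) x)) ` {..<m j})"
    using inj by (simp add: card_image)
  finally have "\<not> (\<lambda>x. \<kappa> (child (h u) x)) ` {..<m j} \<subseteq> B"
    using finS by (auto simp: B_def dest: card_mono[rotated])
  then obtain x where x: "x < m j" "\<kappa> (child (h u) x) \<notin> B" by auto
  define y where "y = child (h u) x"
  have y: "\<kappa> y \<noteq> \<kappa> (h v)" if v: "v \<in> S - {r}" for v
  proof (cases "v = u")
    case True
    thus ?thesis using hu0 col jd hu x(1) v by (auto simp: proper_up_coloring_def y_def)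
  next
    case False
    thus ?thesis using x(2) v by (auto simp: B_def y_def)
  qed
  have h_level: "h v \<in> level m (depth v)" if "v \<in> S" for v
    using h that unfolding rainbow_embedding_def by blast
  have h_up: "parent (h v) = h (up v)" if "v \<in> S - {r}" for v
    using h that unfolding rainbow_embedding_def by blast
  have h_inj: "inj_on (\<lambda>v. \<kappa> (h v)) (S - {r})"
    using h unfolding rainbow_embedding_def by blast
  define h' where "h' = h(w := y)"
  have h'w: "h' w = y" and h'S: "\<And>v. v \<in> S \<Longrightarrow> h' v = h v"
    using w(3) by (auto simp: h'_def)
  have "rainbow_embedding m \<kappa> (insert w S) h'"
    unfolding rainbow_embedding_def
  proof (intro conjI ballI)
    fix v assume "v \<in> insert w S"
    moreover have "y \<in> level m (depth w)" using hu x(1) by (auto simp: dw y_def)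
    ultimately show "h' v \<in> level m (depth v)" using h_level h'S h'w by auto
  next
    fix v assume v: "v \<in> insert w S - {r}"
    show "parent (h' v) = h' (up v)"
    proof (cases "v = w")
      case True
      thus ?thesis using h'w h'S[OF w(4)] by (simp add: y_def u_def)
    next
      case False
      hence "v \<in> S - {r}" using v by blast
      thus ?thesis using h_up h'S S(2) by auto
    qed
  next
    have "inj_on (\<lambda>v. \<kappa> (h' v)) (S - {r}) = inj_on (\<lambda>v. \<kappa> (h v)) (S - {r})"
      using h'S by (intro inj_on_cong) auto
    moreover have "\<kappa> (h' w) \<notin> (\<lambda>v. \<kappa> (h' v)) ` (S - {r} - {w})"
      using y h'w h'S by auto
    moreover have "insert w S - {r} = insert w (S - {r})" using w(2) by auto
    ultimately show "inj_on (\<lambda>v. \<kappa> (h' v)) (insert w S - {r})"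
      using h_inj by (simp only: inj_on_insert simp_thms)
  qed
  thus ?thesis by blast
qed

lemma ex_rainbow_embedding:
  assumes col: "proper_up_coloring m d \<kappa>"
    and bin: "\<And>v. v \<in> verts T \<Longrightarrow> card (children T r v) \<le> 2"
    and m0: "m 0 \<ge> 2" and m: "\<And>j. j \<ge> 1 \<Longrightarrow> m j \<ge> 2 ^ (j + 2) - 3"
    and "k \<le> d"
  shows "\<exists>h. rainbow_embedding m \<kappa> {v \<in> verts T. depth v \<le> k} h"
  using \<open>k \<le> d\<close>
proof (induction k)
  case 0
  have "{v \<in> verts T. depth v \<le> 0} = {r}" using depth_0_imp_root root by auto
  thus ?case by (intro exI[of _ "\<lambda>_. 0"]) (auto simp: rainbow_embedding_def)
next
  case (Suc k)
  let ?V = "{v \<in> verts T. depth v \<le> k}"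
  have "\<exists>h. rainbow_embedding m \<kappa> (?V \<union> A) h"
    if "finite A" "A \<subseteq> {v \<in> verts T. depth v = Suc k}" for A
    using that
  proof (induction A)
    case empty
    thus ?case using Suc by simp
  next
    case (insert w A)
    define S where "S = ?V \<union> A"
    obtain h where h: "rainbow_embedding m \<kappa> S h" using insert by (auto simp: S_def)
    have w: "w \<in> verts T" "depth w = Suc k" "w \<noteq> r" "w \<notin> S"
      using insert by (auto simp: S_def)
    have du: "depth (up w) = k" using up(2) w by force
    have sub: "S \<subseteq> verts T" using insert.prems by (auto simp: S_def)
    have closed: "up v \<in> S" if "v \<in> S - {r}" for v
    proof -
      have "v \<in> verts T" "depth v \<le> Suc k" "v \<noteq> r"
        using that insert.prems by (auto simp: S_def)
      thus ?thesis using up[of v] by (auto simp: S_def)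
    qed
    have finS: "finite S" using sub finite_verts finite_subset by blast
    have "card (insert w S) \<le> card {v \<in> verts T. depth v \<le> Suc k}"
      using finite_verts w insert.prems by (intro card_mono) (auto simp: S_def)
    also have "\<dots> \<le> 2 ^ Suc (Suc k) - 1" by (rule card_depth_le[OF bin])
    finally have "card S + 1 \<le> 2 ^ (k + 2) - 1" using finS w(4) by simp
    moreover have "r \<in> S" using root by (simp add: S_def)
    hence "card (S - {r}) = card S - 1" "card S > 0" using finS by (auto simp: card_gt_0_iff)
    ultimately have c: "card (S - {r}) + 3 \<le> 2 ^ (k + 2)" by simp
    have "card (S - {r}) < m (depth (up w)) + (if up w = r then 0 else 1)"
    proof (cases "k = 0")
      case True
      thus ?thesis using c m0 du by simp
    next
      case False
      hence "up w \<noteq> r" using du by auto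
      thus ?thesis using c m[of k] False du by simp
    qed
    moreover have "up w \<in> S" using up(3)[OF w(1,3)] du by (auto simp: S_def)
    ultimately have "\<exists>h. rainbow_embedding m \<kappa> (insert w S) h"
      using rainbow_embedding_insert[OF col h sub closed w(1,3,4)] w(2) Suc.prems by auto
    thus ?case by (simp add: S_def)
  qed
  from this[of "{v \<in> verts T. depth v = Suc k}"] finite_verts
  have "\<exists>h. rainbow_embedding m \<kappa> (?V \<union> {v \<in> verts T. depth v = Suc k}) h" by simp
  moreover have "?V \<union> {v \<in> verts T. depth v = Suc k} = {v \<in> verts T. depth v \<le> Suc k}" by auto
  ultimately show ?case by simp
qed

lemma inj_on_rainbow_embedding:
  assumes "rainbow_embedding m \<kappa> (verts T) h"
  shows "inj_on h (verts T)"
proof -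
  have "inj_on h (verts T - {r})"
    using assms by (auto simp: rainbow_embedding_def inj_on_def)
  moreover have "h v \<noteq> h r" if "v \<in> verts T - {r}" for v
  proof
    assume "h v = h r"
    hence "h r \<in> level m (depth v)" "h r \<in> level m (depth r)"
      using assms that root by (auto simp: rainbow_embedding_def simp del: depth_root)
    hence "depth v = 0" using level_disjoint by fastforce
    thus False using that depth_0_imp_root by auto
  qed
  hence "h r \<notin> h ` (verts T - {r})" by (metis imageE)
  ultimately have "inj_on h (insert r (verts T - {r}))"
    unfolding inj_on_insert Diff_idemp by (rule conjI)
  thus ?thesis using root by (simp add: insert_absorb)
qed

end

lemma contains_rainbow_copy_if_contains_level_tree:
  fixes G :: "'b sgraph" and c :: "'b set \<Rightarrow> 'c"
  assumes T: "perfect_kary_tree 2 d T r"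
    and G: "simple_graph G" "proper_coloring G c"
    and copy: "contains_copy G (level_tree m d)"
    and m: "m 0 \<ge> 2" "\<And>j. j \<ge> 1 \<Longrightarrow> m j \<ge> 2 ^ (j + 2) - 3"
  shows "contains_rainbow_copy G c T"
proof -
  interpret rooted_tree T r
    using T by unfold_locales (auto simp: perfect_kary_tree_def kary_tree_def)
  let ?L = "level_tree m d"
  obtain f H0 where fH: "subgraph H0 G" "bij_betw f (verts ?L) (verts H0)"
      "edges H0 = (\<lambda>e. f ` e) ` edges ?L"
    using copy unfolding contains_copy_def isomorphic_def by blast
  have f: "inj_on f (verts ?L)" "\<And>v. v \<in> verts ?L \<Longrightarrow> f v \<in> verts G"
      "\<And>e. e \<in> edges ?L \<Longrightarrow> f ` e \<in> edges G"
    using fH unfolding subgraph_def bij_betw_def by blast+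
  have lv: "level m j \<subseteq> verts ?L" if "j \<le> d" for j
    using that by (auto simp: level_tree_def)
  define \<kappa> where "\<kappa> w = c (f ` {w, parent w})" for w
  have edge: "{w, parent w} \<in> edges ?L" "{w, parent w} \<subseteq> verts ?L" "parent w < w"
    if "w \<in> level m (Suc j)" "j < d" for w j
  proof -
    have "Suc j \<in> {1..d}" using that by simp
    thus "{w, parent w} \<in> edges ?L"
      using that(1) unfolding level_tree_def snd_conv by blast
    thus "{w, parent w} \<subseteq> verts ?L"
      using simple_graph_level_tree[of m d] unfolding simple_graph_def by blast
    show "parent w < w" using parent_less that(1) .
  qed
  \<comment> \<open>Two edges of the level tree that share a vertex receive different colors.\<close>
  have neq: "\<kappa> w \<noteq> \<kappa> w'"
    if w: "w \<in> level m (Suc j)" "j < d" "w' \<in> level m (Suc j')" "j' < d" "w \<noteq> w'"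
      and meet: "{w, parent w} \<inter> {w', parent w'} \<noteq> {}" for w w' j j'
  proof -
    have "{w, parent w} \<noteq> {w', parent w'}"
      using edge(3)[OF w(1,2)] edge(3)[OF w(3,4)] w(5) by (auto simp: doubleton_eq_iff)
    hence "f ` {w, parent w} \<noteq> f ` {w', parent w'}"
      using inj_on_image_eq_iff[OF f(1) edge(2)[OF w(1,2)] edge(2)[OF w(3,4)]] by simp
    moreover have "f ` {w, parent w} \<inter> f ` {w', parent w'} \<noteq> {}" using meet by auto
    ultimately show ?thesis
      using G(2)[unfolded proper_coloring_def, rule_format,
          OF f(3)[OF edge(1)[OF w(1,2)]] f(3)[OF edge(1)[OF w(3,4)]]]
      unfolding \<kappa>_def by simp
  qed
  have "proper_up_coloring m d \<kappa>"
    unfolding proper_up_coloring_def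
  proof (intro allI impI ballI conjI)
    fix j v assume j: "j < d" and v: "v \<in> level m j"
    have ch: "child v x \<in> level m (Suc j)" if "x < m j" for x using v that by auto
    show "inj_on (\<lambda>x. \<kappa> (child v x)) {..<m j}"
    proof (rule inj_onI)
      fix x y assume xy: "x \<in> {..<m j}" "y \<in> {..<m j}" "\<kappa> (child v x) = \<kappa> (child v y)"
      show "x = y"
        using neq[OF ch[of x] j ch[of y] j] xy by (cases "x = y") auto
    qed
    fix x assume "v \<noteq> 0" and x: "x < m j"
    then obtain i where i: "j = Suc i" using v by (cases j) auto
    show "\<kappa> (child v x) \<noteq> \<kappa> v"
      using neq[OF ch[OF x] j, of v i] v j less_child[of v x] unfolding i by auto
  qed
  moreover have "card (children T r v) \<le> 2" if "v \<in> verts T" for v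
    using T that by (cases "is_leaf T r v")
      (auto simp: perfect_kary_tree_def kary_tree_def is_leaf_def)
  ultimately have "\<exists>h. rainbow_embedding m \<kappa> {v \<in> verts T. depth v \<le> d} h"
    using ex_rainbow_embedding m by blast
  moreover have "{v \<in> verts T. depth v \<le> d} = verts T"
    using perfect_kary_tree_depth(1)[OF T] by auto
  ultimately obtain h where h: "rainbow_embedding m \<kappa> (verts T) h" by auto
  define g where "g v = f (h v)" for v
  have hv: "h v \<in> verts ?L" if "v \<in> verts T" for v
    using h that lv perfect_kary_tree_depth(1)[OF T]
    by (auto simp: rainbow_embedding_def)
  have injg: "inj_on g (verts T)"
    using inj_on_rainbow_embedding[OF h] f(1) hv unfolding g_def inj_on_def by blast
  have g_edge: "g ` {v, up v} = f ` {h v, parent (h v)}" if "v \<in> verts T - {r}" for v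
    using h that by (simp add: rainbow_embedding_def g_def)
  have g_edges: "g ` {v, up v} \<in> edges G" if v: "v \<in> verts T - {r}" for v
  proof -
    have "h v \<in> level m (Suc (depth (up v)))" "depth (up v) < d"
      using h v up[of v] perfect_kary_tree_depth(1)[OF T]
      by (force simp: rainbow_embedding_def simp del: level.simps)+
    thus ?thesis using f(3) edge(1) g_edge[OF v] by metis
  qed
  define H where "H = (g ` verts T, (\<lambda>e. g ` e) ` edges T)"
  have HG: "edges H \<subseteq> edges G"
    unfolding H_def edges_eq snd_conv using g_edges by blast
  have "simple_graph H"
    unfolding simple_graph_def
  proof (intro conjI ballI)
    show "finite (verts H)" using finite_verts by (simp add: H_def)
  next
    fix e assume e: "e \<in> edges H"
    thus "card e = 2" using HG G(1) unfolding simple_graph_def by blast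
    obtain e' where e': "e' \<in> edges T" "e = g ` e'" using e by (auto simp: H_def)
    have "e' \<subseteq> verts T" using e'(1) tree unfolding is_tree_def simple_graph_def by blast
    thus "e \<subseteq> verts H" using e'(2) by (simp add: H_def image_mono)
  qed
  hence "subgraph H G"
    using HG f(2) hv by (auto simp: subgraph_def H_def g_def)
  moreover have "isomorphic T H"
    using injg by (auto simp: isomorphic_def H_def bij_betw_def)
  moreover have "rainbow c H"
  proof -
    have "inj_on (\<lambda>v. c (g ` {v, up v})) (verts T - {r})"
      using h g_edge by (simp add: rainbow_embedding_def \<kappa>_def inj_on_def)
    hence "inj_on c ((\<lambda>v. g ` {v, up v}) ` (verts T - {r}))"
      by (intro inj_on_imageI) (simp add: o_def)
    moreover have "edges H = (\<lambda>v. g ` {v, up v}) ` (verts T - {r})"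
      by (simp add: H_def edges_eq image_image)
    ultimately show ?thesis by (simp add: rainbow_def)
  qed
  ultimately show ?thesis unfolding contains_rainbow_copy_def by blast
qed


section \<open>Turan numbers\<close>

text \<open>This crude bound makes the sets in the definitions of the Turan numbers finite.\<close>

lemma card_edges_le:
  assumes "simple_graph G" "card (verts G) = n"
  shows "card (edges G) \<le> 2 ^ n"
proof -
  have "finite (verts G)" "edges G \<subseteq> Pow (verts G)" using assms by (auto simp: simple_graph_def)
  thus ?thesis using card_mono[of "Pow (verts G)" "edges G"] assms by (simp add: card_Pow)
qed

lemma ex_ge:
  fixes G :: "nat sgraph"
  assumes "simple_graph G" "card (verts G) = n" "\<not> contains_copy G F"
  shows "card (edges G) \<le> ex n F"
  unfolding ex_def
proof (rule Max_ge)
  show "finite {card (edges G) | G :: nat sgraph.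
      simple_graph G \<and> card (verts G) = n \<and> \<not> contains_copy G F}"
    (is "finite ?X")
  proof (rule finite_subset)
    show "?X \<subseteq> {..2 ^ n}" using card_edges_le by blast
  qed simp
qed (use assms in blast)

text \<open>The edgeless graph on \<open>n\<close> vertices shows that the maximum is over a nonempty set.\<close>

lemma ex_star_attained:
  assumes "edges F \<noteq> {}"
  shows "\<exists>(G :: nat sgraph) (c :: nat set \<Rightarrow> nat). simple_graph G \<and> card (verts G) = n \<and>
    proper_coloring G c \<and> \<not> contains_rainbow_copy G c F \<and> ex_star n F = card (edges G)"
proof -
  let ?X = "{card (edges G) | G :: nat sgraph. simple_graph G \<and> card (verts G) = n \<and>
     (\<exists>c :: nat set \<Rightarrow> nat. proper_coloring G c \<and> \<not> contains_rainbow_copy G c F)}"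
  have "?X \<subseteq> {..2 ^ n}" using card_edges_le by blast
  hence "finite ?X" by (rule finite_subset) simp
  moreover have "card (edges ({..<n}, {} :: nat set set)) \<in> ?X"
  proof -
    have "simple_graph ({..<n}, {} :: nat set set)" by (simp add: simple_graph_def)
    moreover have "proper_coloring ({..<n}, {}) (\<lambda>_. 0 :: nat)"
      by (simp add: proper_coloring_def)
    moreover have "\<not> contains_rainbow_copy ({..<n}, {}) (\<lambda>_. 0 :: nat) F"
      using assms by (auto simp: contains_rainbow_copy_def subgraph_def isomorphic_def)
    moreover have "card (verts ({..<n}, {} :: nat set set)) = n" by simp
    ultimately show ?thesis
      by (intro CollectI exI[of _ "({..<n}, {} :: nat set set)"] conjI) auto
  qed
  ultimately have "ex_star n F \<in> ?X"
    unfolding ex_star_def by (intro Max_in) (simp_all only: ex_in_conv[symmetric], rule exI)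
  thus ?thesis by blast
qed

text \<open>The number of children at depth \<open>j\<close> that the greedy embedding of a binary tree needs.
  The root is exceptional because there is no edge above it.\<close>

definition greedy_branching :: "nat \<Rightarrow> nat" where
  "greedy_branching j = (if j = 0 then 2 else 2 ^ (j + 2) - 3)"

lemma prod_greedy_branching:
  "real (\<Prod>i<Suc j. greedy_branching i) = 2 * (\<Prod>i=2..Suc j. (2::real) ^ (i + 1) - 3)"
proof (induction j)
  case 0
  show ?case by (simp add: greedy_branching_def)
next
  case (Suc j)
  have "(4::nat) \<le> 2 ^ (j + 3)" using power_increasing[of 2 "j + 3" "2::nat"] by simp
  hence "real (greedy_branching (Suc j)) = 2 ^ (Suc (Suc j) + 1) - 3"
    by (simp add: greedy_branching_def of_nat_diff power_add numeral_eq_Suc)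
  thus ?case using Suc by (simp add: prod.lessThan_Suc[of _ "Suc j"] mult.assoc)
qed

lemma card_edges_greedy_tree:
  assumes "d \<ge> 1"
  shows "real (card (edges (level_tree greedy_branching d)))
    = (\<Sum>j = 2..d. 2 * (\<Prod>i = 2..j. (2::real) ^ (i + 1) - 3)) + 2"
proof -
  let ?P = "\<lambda>j. 2 * (\<Prod>i = 2..j. (2::real) ^ (i + 1) - 3)"
  have "real (\<Prod>i<j. greedy_branching i) = ?P j" if "j \<in> {1..d}" for j
  proof -
    from that obtain i where "j = Suc i" by (cases j) auto
    thus ?thesis by (simp only: prod_greedy_branching)
  qed
  hence "real (card (edges (level_tree greedy_branching d))) = (\<Sum>j=1..d. ?P j)"
    unfolding card_edges_level_tree of_nat_sum by (rule sum.cong[OF refl])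
  also have "\<dots> = ?P 1 + (\<Sum>j=Suc 1..d. ?P j)"
    using assms by (rule sum.atLeast_Suc_atMost)
  finally show ?thesis by (simp add: numeral_2_eq_2)
qed

theorem theorem4p13:
  fixes T :: "'a sgraph" and r :: 'a and d n :: nat
  assumes "erdos_sos_conjecture"
    and "d \<ge> 1"
    and "perfect_kary_tree 2 d T r"
  shows "real (ex_star n T) \<le>
    ((\<Sum>j = 2..d. 2 * (\<Prod>i = 2..j. (2::real) ^ (i + 1) - 3)) + 1) * (real n / 2)"
proof -
  interpret rooted_tree T r
    using assms(3) by unfold_locales (auto simp: perfect_kary_tree_def kary_tree_def)
  let ?L = "level_tree greedy_branching d"
  obtain v where v: "v \<in> verts T" "depth v = d"
    using perfect_kary_tree_depth(2)[OF assms(3)] by blast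
  hence "v \<noteq> r" using assms(2) by auto
  hence "edges T \<noteq> {}" using v(1) by (auto simp: edges_eq)
  then obtain G :: "nat sgraph" and c :: "nat set \<Rightarrow> nat" where
    G: "simple_graph G" "card (verts G) = n" "proper_coloring G c"
      "\<not> contains_rainbow_copy G c T" "ex_star n T = card (edges G)"
    using ex_star_attained by blast
  have "\<not> contains_copy G ?L"
    using contains_rainbow_copy_if_contains_level_tree[OF assms(3) G(1,3), of greedy_branching]
      G(4) by (auto simp: greedy_branching_def)
  hence "real (ex_star n T) \<le> real (ex n ?L)"
    using ex_ge G by simp
  also have "\<dots> \<le> (real (card (edges ?L)) - 1) * real n / 2"
  proof -
    have "edges ?L \<noteq> {}"
    proof -
      have "card (level greedy_branching 1) = 2"
        unfolding card_level by (simp add: greedy_branching_def)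
      hence "level greedy_branching 1 \<noteq> {}" by (metis card.empty zero_neq_numeral)
      moreover have "1 \<in> {1..d}" using assms(2) by simp
      ultimately show ?thesis unfolding level_tree_def snd_conv by blast
    qed
    moreover have "finite (edges ?L)" by (simp add: level_tree_def finite_level)
    ultimately have "card (edges ?L) \<ge> 1" by (simp add: Suc_le_eq card_gt_0_iff)
    thus ?thesis
      using assms(1) is_tree_level_tree unfolding erdos_sos_conjecture_def by blast
  qed
  finally show ?thesis by (simp add: card_edges_greedy_tree[OF assms(2)] add.commute)
qed

end
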